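(* Among the $3$-dimensional complex associative algebras listed in the context, the algebra $d_{15}$ has jump deformations to every listed algebra other than itself except $d_7$, $d_8$, $d_{20}$ and $d_{22}(1:-1)$, and it has no jump deformation to any of these four. That is, $d_{15}$ has jump deformations exactly to $d_1,d_2,d_3,d_4,d_5,d_6,d_9,d_{10},d_{11},d_{12},d_{13},d_{14},d_{16},d_{17},d_{18},d_{19},d_{21}$ and to $d_{22}(x:y)$ for every $(x:y)\in\mathbb{P}^1(\mathbb{C})$ with $(x:y)\neq(1:-1)$.
   Context: Associative algebras are not assumed unital or commutative. $V$ is a complex vector space with basis $e_1,e_2,e_3$, and $\psi^{i,j}_k$ denotes the bilinear map $V\times V\to V$ with $\psi^{i,j}_k(e_i,e_j)=e_k$ and $\psi^{i,j}_k(e_m,e_n)=0$ for $(m,n)\neq(i,j)$. An algebra structure is identified with its product $d$. A jump deformation from $d$ to a non-isomorphic structure $d'$ is a family $d_t=d+t\psi_1+t^2\psi_2+\cdots$ of associative products on $V$ (with bilinear $\psi_i:V\times V\to V$), given by a power series convergent for small $t$, such that $d_t$ is isomorphic to $d'$ for all sufficiently small $t\neq 0$. The list of products is: $d_1=\psi^{1,1}_1$; $d_2=\psi^{1,1}_1+\psi^{2,2}_3$; $d_3=\psi^{1,1}_1+\psi^{1,3}_3$; $d_4=\psi^{1,1}_1+\psi^{3,1}_3$; $d_5=\psi^{1,1}_1+\psi^{1,3}_3+\psi^{3,1}_3$; $d_6=\psi^{1,1}_1+\psi^{3,3}_3$; $d_7=\psi^{1,1}_1+\psi^{2,1}_2+\psi^{1,3}_3$;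 $d_8=\psi^{1,1}_1+\psi^{2,1}_2+\psi^{3,1}_3$; $d_9=\psi^{1,1}_1+\psi^{2,1}_2+\psi^{1,3}_3+\psi^{3,1}_3$; $d_{10}=\psi^{1,1}_1+\psi^{2,1}_2+\psi^{3,3}_3$; $d_{11}=\psi^{1,1}_1+\psi^{2,2}_2+\psi^{2,3}_3$; $d_{12}=\psi^{1,1}_1+\psi^{2,2}_2+\psi^{2,3}_3+\psi^{3,2}_3$; $d_{13}=\psi^{1,1}_1+\psi^{2,2}_2+\psi^{2,3}_3+\psi^{3,1}_3$; $d_{14}=\psi^{1,1}_1+\psi^{2,2}_2+\psi^{3,3}_3$; $d_{15}=\psi^{1,1}_2$; $d_{16}=\psi^{1,1}_2+\psi^{1,2}_3+\psi^{2,1}_3$; $d_{17}=\psi^{1,1}_1+\psi^{1,1}_2+\psi^{1,2}_2+\psi^{2,1}_2+\psi^{1,3}_3$; $d_{18}=\psi^{1,1}_1+\psi^{1,1}_2+\psi^{1,2}_2+\psi^{2,1}_2+\psi^{1,3}_3+\psi^{3,1}_3$; $d_{19}=\psi^{3,3}_3+\psi^{1,1}_2+\psi^{1,3}_1+\psi^{3,1}_1+\psi^{2,3}_2+\psi^{3,2}_2$; $d_{20}=\psi^{1,1}_1+\psi^{1,2}_2+\psi^{1,3}_3$; $d_{21}=\psi^{1,1}_3+\psi^{1,2}_3-\psi^{2,1}_3$; $d_{22}(x:y)=x\,\psi^{1,2}_3+y\,\psi^{2,1}_3$ for $(x:y)\in\mathbb{P}^1(\mathbb{C})$. *)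

theory Defs
  imports "HOL-Analysis.Analysis"
begin

type_synonym V = "complex ^ 3"
type_synonym product = "V \<Rightarrow> V \<Rightarrow> V"

definition e :: "3 \<Rightarrow> V" where
  "e i = axis i 1"

text \<open>The library constant \<^const>\<open>bilinear\<close> only expresses real bilinearity.\<close>

definition complex_linear :: "(V \<Rightarrow> V) \<Rightarrow> bool" where
  "complex_linear f \<longleftrightarrow> Vector_Spaces.linear (*s) (*s) f"

definition complex_bilinear :: "product \<Rightarrow> bool" where
  "complex_bilinear f \<longleftrightarrow>
     (\<forall>u. complex_linear (\<lambda>v. f u v)) \<and> (\<forall>v. complex_linear (\<lambda>u. f u v))"

definition associative :: "product \<Rightarrow> bool" where
  "associative f \<longleftrightarrow> (\<forall>u v w. f (f u v) w = f u (f v w))"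

definition isomorphic :: "product \<Rightarrow> product \<Rightarrow> bool" where
  "isomorphic f g \<longleftrightarrow>
     (\<exists>\<phi>. complex_linear \<phi> \<and> bij \<phi> \<and> (\<forall>u v. \<phi> (f u v) = g (\<phi> u) (\<phi> v)))"

text \<open>The deformation parameter \<open>t\<close> is complex. The term \<open>\<psi> 0 = d\<close> is the constant term of the
  power series. As \<open>V\<close> is finite-dimensional, convergence of a series of bilinear maps is
  convergence of its values at every pair of vectors.\<close>

definition jump_deformation :: "product \<Rightarrow> product \<Rightarrow> bool" where
  "jump_deformation d d' \<longleftrightarrow>
     \<not> isomorphic d d' \<and>
     (\<exists>(\<psi> :: nat \<Rightarrow> product) (D :: complex \<Rightarrow> product) \<epsilon> :: real.
        \<psi> 0 = d \<and> (\<forall>n. complex_bilinear (\<psi> n)) \<and> \<epsilon> > 0 \<and>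
        (\<forall>t. norm t < \<epsilon> \<longrightarrow>
           (\<forall>u v. (\<lambda>n. t ^ n *s \<psi> n u v) sums D t u v) \<and> associative (D t)) \<and>
        (\<forall>t. t \<noteq> 0 \<and> norm t < \<epsilon> \<longrightarrow> isomorphic (D t) d'))"

definition psi :: "3 \<Rightarrow> 3 \<Rightarrow> 3 \<Rightarrow> product" where
  "psi i j k u v = (u $ i * v $ j) *s e k"

lemma psi_basis: "psi i j k (e m) (e n) = (if (m, n) = (i, j) then e k else 0)"
  by (auto simp: psi_def e_def axis_def)

lemma complex_bilinear_psi: "complex_bilinear (psi i j k)"
  unfolding complex_bilinear_def complex_linear_def psi_def
  by (intro conjI allI; unfold_locales; simp add: vec_eq_iff algebra_simps)

definition d1 :: product where
  "d1 u v = psi 1 1 1 u v"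

definition d2 :: product where
  "d2 u v = psi 1 1 1 u v + psi 2 2 3 u v"

definition d3 :: product where
  "d3 u v = psi 1 1 1 u v + psi 1 3 3 u v"

definition d4 :: product where
  "d4 u v = psi 1 1 1 u v + psi 3 1 3 u v"

definition d5 :: product where
  "d5 u v = psi 1 1 1 u v + psi 1 3 3 u v + psi 3 1 3 u v"

definition d6 :: product where
  "d6 u v = psi 1 1 1 u v + psi 3 3 3 u v"

definition d7 :: product where
  "d7 u v = psi 1 1 1 u v + psi 2 1 2 u v + psi 1 3 3 u v"

definition d8 :: product where
  "d8 u v = psi 1 1 1 u v + psi 2 1 2 u v + psi 3 1 3 u v"

definition d9 :: product where
  "d9 u v = psi 1 1 1 u v + psi 2 1 2 u v + psi 1 3 3 u v + psi 3 1 3 u v"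

definition d10 :: product where
  "d10 u v = psi 1 1 1 u v + psi 2 1 2 u v + psi 3 3 3 u v"

definition d11 :: product where
  "d11 u v = psi 1 1 1 u v + psi 2 2 2 u v + psi 2 3 3 u v"

definition d12 :: product where
  "d12 u v = psi 1 1 1 u v + psi 2 2 2 u v + psi 2 3 3 u v + psi 3 2 3 u v"

definition d13 :: product where
  "d13 u v = psi 1 1 1 u v + psi 2 2 2 u v + psi 2 3 3 u v + psi 3 1 3 u v"

definition d14 :: product where
  "d14 u v = psi 1 1 1 u v + psi 2 2 2 u v + psi 3 3 3 u v"

definition d15 :: product where
  "d15 u v = psi 1 1 2 u v"

definition d16 :: product where
  "d16 u v = psi 1 1 2 u v + psi 1 2 3 u v + psi 2 1 3 u v"

definition d17 :: product where
  "d17 u v = psi 1 1 1 u v + psi 1 1 2 u v + psi 1 2 2 u v + psi 2 1 2 u v + psi 1 3 3 u v"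

definition d18 :: product where
  "d18 u v = psi 1 1 1 u v + psi 1 1 2 u v + psi 1 2 2 u v + psi 2 1 2 u v + psi 1 3 3 u v + psi 3 1 3 u v"

definition d19 :: product where
  "d19 u v = psi 3 3 3 u v + psi 1 1 2 u v + psi 1 3 1 u v + psi 3 1 1 u v + psi 2 3 2 u v + psi 3 2 2 u v"

definition d20 :: product where
  "d20 u v = psi 1 1 1 u v + psi 1 2 2 u v + psi 1 3 3 u v"

definition d21 :: product where
  "d21 u v = psi 1 1 3 u v + psi 1 2 3 u v - psi 2 1 3 u v"

definition d22 :: "complex \<Rightarrow> complex \<Rightarrow> product" where
  "d22 x y u v = x *s psi 1 2 3 u v + y *s psi 2 1 3 u v"

text \<open>A point \<open>(x : y)\<close> of the projective line is given by homogeneous coordinates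
  \<open>(x, y) \<noteq> (0, 0)\<close>; statements about points are quantified over all such coordinates.\<close>

definition same_point :: "complex \<times> complex \<Rightarrow> complex \<times> complex \<Rightarrow> bool" where
  "same_point p q \<longleftrightarrow> (\<exists>c. c \<noteq> 0 \<and> fst p = c * fst q \<and> snd p = c * snd q)"

end

theory Submission
  imports Defs
begin

text \<open>
  In \<open>d15\<close> the vector \<open>e 1\<close> is not proportional to its square \<open>e 2\<close>. For an associative algebra
  \<open>g\<close> that is not isomorphic to \<open>d15\<close>, the existence of such a vector is the exact condition for a
  jump deformation from \<open>d15\<close> to \<open>g\<close>.

  If some \<open>u\<close> is not proportional to \<open>g u u\<close>, complete \<open>u, g u u\<close> by a vector \<open>w\<close> to a basis and
  rescale it to \<open>t u, t\<^sup>2 (g u u), t\<^sup>2 w\<close>. A product of basis vectors of weights \<open>i\<close> and \<open>j\<close>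
  then has its coefficient at a basis vector of weight \<open>k\<close> multiplied by \<open>t ^ (i + j - k)\<close>. Since
  all weights are \<open>1\<close> or \<open>2\<close>, the exponent is nonnegative, and it vanishes only for the components
  of weight \<open>2\<close> of the square of the first vector. That square is exactly the second vector, so the
  structure constants are polynomials in \<open>t\<close> whose constant terms are those of \<open>d15\<close>. This is
  \<open>d15_jump_deformation\<close>.

  Conversely, if every vector is proportional to its square in \<open>g\<close>, the same holds in every algebra
  isomorphic to \<open>g\<close>; it is a closed condition on the product, so it would pass to the limit \<open>d15\<close>,
  where it fails for \<open>e 1\<close>. This is \<open>d15_no_jump_deformation\<close>.

  Squares are proportional in \<open>d7\<close>, \<open>d8\<close> and \<open>d20\<close>, where \<open>u\<close> squares to \<open>u $ 1\<close> times \<open>u\<close>, and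
  in the anticommutative algebra \<open>d22 x (- x)\<close>, where all squares vanish. All the other listed
  algebras have a vector that is not proportional to its square. Except for \<open>d15\<close> they are told apart from \<open>d15\<close> by
  two of its properties: all products of three vectors vanish, and a vector with zero square
  annihilates everything.
\<close>

section \<open>Linear maps and isomorphisms\<close>

lemma complex_linearD:
  assumes "complex_linear f"
  shows "f (x + y) = f x + f y" and "f (c *s x) = c *s f x"
  using assms unfolding complex_linear_def
  by (auto simp: Vector_Spaces.linear_def module_hom_def module_hom_axioms_def)

lemma complex_linearI:
  assumes "\<And>x y. f (x + y) = f x + f y" and "\<And>c x. f (c *s x) = c *s f x"
  shows "complex_linear f"
  unfolding complex_linear_def using assms by unfold_locales auto

lemma complex_bilinearD:
  assumes "complex_bilinear f"
  shows "f (x + y) z = f x z + f y z" and "f z (x + y) = f z x + f z y"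
    and "f (c *s x) z = c *s f x z" and "f z (c *s x) = c *s f z x"
  using assms complex_linearD unfolding complex_bilinear_def by blast+

lemma complex_bilinearI:
  assumes "\<And>x y z. f (x + y) z = f x z + f y z" and "\<And>x y z. f z (x + y) = f z x + f z y"
    and "\<And>c x z. f (c *s x) z = c *s f x z" and "\<And>c x z. f z (c *s x) = c *s f z x"
  shows "complex_bilinear f"
  unfolding complex_bilinear_def using assms by (auto intro!: complex_linearI)

lemma isomorphic_refl: "isomorphic f f"
  unfolding isomorphic_def
  by (rule exI[of _ id]) (auto intro!: complex_linearI)

lemma associative_isomorphic:
  assumes "isomorphic f g" and "associative g"
  shows "associative f"
proof -
  obtain \<phi> where "bij \<phi>" and hom: "\<And>u v. \<phi> (f u v) = g (\<phi> u) (\<phi> v)"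
    using assms(1) unfolding isomorphic_def by blast
  have "\<phi> (f (f u v) w) = \<phi> (f u (f v w))" for u v w
    using assms(2) by (simp add: hom associative_def)
  with \<open>bij \<phi>\<close> show ?thesis
    unfolding associative_def by (meson bij_is_inj injD)
qed

lemma e_nth [simp]:
  "e 1 $ 1 = 1" "e 1 $ 2 = 0" "e 1 $ 3 = 0"
  "e 2 $ 1 = 0" "e 2 $ 2 = 1" "e 2 $ 3 = 0"
  "e 3 $ 1 = 0" "e 3 $ 2 = 0" "e 3 $ 3 = 1"
  by (simp_all add: e_def axis_def)

lemma exists_basis_extension:
  fixes u v :: V
  assumes nm: "\<And>c. v \<noteq> c *s u" and "u \<noteq> 0"
  obtains P where "complex_linear P" and "bij P" and "P (e 1) = u" and "P (e 2) = v"
proof -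
  have ind: "vec.independent {u, v}"
    using nm \<open>u \<noteq> 0\<close> nm[of 1] vec.independent_insert[of v "{u}"]
    by (auto simp: insert_commute vec.span_singleton)
  define B where "B = vec.extend_basis {u, v}"
  have B: "{u, v} \<subseteq> B" "vec.independent B" "vec.span B = UNIV"
    using ind vec.extend_basis_superset vec.independent_extend_basis vec.span_extend_basis
    by (auto simp: B_def)
  \<comment> \<open>Counting shows that the extended basis adds exactly one vector.\<close>
  have "card B = 3"
    using vec.dim_eq_card[of B UNIV] B by (simp add: vec.dim_UNIV card_cart_basis)
  moreover have "finite B" using B(2) by (rule vec.finiteI_independent)
  moreover have "u \<noteq> v" using nm[of 1] by auto
  ultimately have "card (B - {u, v}) = 1"
    using B(1) by (simp add: card_Diff_subset)
  then obtain w where "B - {u, v} = {w}" by (auto simp: card_1_singleton_iff)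
  with B(1) have Bw: "B = {u, v, w}" by auto
  define P where "P a = a $ 1 *s u + a $ 2 *s v + a $ 3 *s w" for a :: V
  have lin: "complex_linear P"
    by (rule complex_linearI) (simp_all add: P_def vec_eq_iff algebra_simps)
  have "surj P"
  proof -
    have "x \<in> range P" for x
    proof -
      have "x \<in> vec.span {u, v, w}" using B(3) Bw by simp
      then obtain a b c where "x = a *s u + b *s v + c *s w"
        by (auto simp: vec.span_insert vec.span_singleton algebra_simps)
      then have "x = P (vector [a, b, c])" by (simp add: P_def vector_3)
      then show ?thesis by simp
    qed
    then show ?thesis by blast
  qed
  moreover have "inj P"
    using lin \<open>surj P\<close> vec.linear_surj_imp_inj unfolding complex_linear_def by blast
  ultimately have "bij P" by (simp add: bij_def)
  with lin show thesis by (rule that) (simp_all add: P_def)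
qed

section \<open>Existence and obstruction of deformations of \<open>d15\<close>\<close>

text \<open>The basis \<open>P (e 1) = u, P (e 2) = g u u, P (e 3)\<close> transports \<open>g\<close> to a product \<open>m\<close>, and the
  rescaling described above is \<open>S t\<close>. Splitting vectors into their parts \<open>p\<close> of weight \<open>1\<close> and \<open>q\<close>
  of weight \<open>2\<close> avoids structure constants: sorting \<open>m (S t a) (S t b)\<close> by powers of \<open>t\<close> and undoing
  \<open>S t\<close> on the result yields a polynomial of degree \<open>3\<close> in \<open>t\<close>.\<close>

lemma d15_jump_deformation:
  assumes bil: "complex_bilinear g" and "associative g" and "\<not> isomorphic d15 g"
    and nm: "\<And>c. g u u \<noteq> c *s u"
  shows "jump_deformation d15 g"
proof -
  note gD = complex_bilinearD[OF bil]
  have "u \<noteq> 0" using nm[of 1] gD(3)[of 0 0 0] by auto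
  obtain P where P: "complex_linear P" "bij P" "P (e 1) = u" "P (e 2) = g u u"
    using exists_basis_extension[OF nm \<open>u \<noteq> 0\<close>] by blast
  define Q where "Q = inv P"
  have PQ: "P (Q x) = x" and QP: "Q (P x) = x" for x
    using P(2) by (simp_all add: Q_def bij_is_surj surj_f_inv_f bij_is_inj)
  note PD = complex_linearD[OF P(1)]
  have QD: "Q (x + y) = Q x + Q y" "Q (c *s x) = c *s Q x" for x y c
    by (metis PD PQ QP)+
  define m where "m a b = Q (g (P a) (P b))" for a b
  have Pm: "P (m a b) = g (P a) (P b)" for a b by (simp add: m_def PQ)
  have "complex_bilinear m"
    by (rule complex_bilinearI) (simp_all add: m_def PD QD gD)
  note mD = complex_bilinearD[OF this]
  have m11: "m (e 1) (e 1) = e 2" by (metis P(3,4) QP m_def)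
  define p :: "V \<Rightarrow> V" where "p a = a $ 1 *s e 1" for a
  define q :: "V \<Rightarrow> V" where "q a = a - p a" for a
  have pD: "p (x + y) = p x + p y" "p (c *s x) = c *s p x" for x y c
    by (simp_all add: p_def vec_eq_iff algebra_simps)
  have qD: "q (x + y) = q x + q y" "q (c *s x) = c *s q x" for x y c
    by (simp_all add: p_def q_def vec_eq_iff algebra_simps)
  have pq: "p x + q x = x" "p (p x) = p x" "q (p x) = 0" "p (q x) = 0" "q (q x) = q x" for x
    by (simp_all add: p_def q_def vec_eq_iff)
  define S where "S t a = t *s p a + t^2 *s q a" for t a
  define \<psi> :: "nat \<Rightarrow> product" where "\<psi> n a b =
     (if n = 0 then q (m (p a) (p b))
      else if n = 1 then p (m (p a) (p b)) + q (m (p a) (q b) + m (q a) (p b))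
      else if n = 2 then p (m (p a) (q b) + m (q a) (p b)) + q (m (q a) (q b))
      else if n = 3 then p (m (q a) (q b)) else 0)" for n a b
  define D where "D t a b = (\<Sum>n\<in>{..3}. t ^ n *s \<psi> n a b)" for t a b
  \<comment> \<open>The constant term only depends on \<open>m (e 1) (e 1) = e 2\<close>.\<close>
  have psi0: "\<psi> 0 = d15"
    by (intro ext)
      (simp add: \<psi>_def p_def mD m11 d15_def psi_def q_def vec_eq_iff mult.commute)
  have "complex_bilinear (\<psi> n)" for n
    by (rule complex_bilinearI)
      (simp_all add: \<psi>_def pD qD mD vector_add_ldistrib add_ac)
  moreover have "(\<lambda>n. t ^ n *s \<psi> n a b) sums D t a b" for t a b
    unfolding D_def by (rule sums_finite) (auto simp: \<psi>_def)
  moreover have iso: "isomorphic (D t) g" if "t \<noteq> 0" for t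
  proof -
    define R where "R a = inverse t *s p a + inverse (t^2) *s q a" for a
    have "complex_linear (S t)"
      by (rule complex_linearI) (simp_all add: S_def pD qD vec_eq_iff algebra_simps)
    then have lin: "complex_linear (P \<circ> S t)"
      by (auto intro!: complex_linearI simp: PD complex_linearD)
    have "R (S t a) = a" "S t (R a) = a" for a
      using \<open>t \<noteq> 0\<close> pq(1)[of a]
      by (simp_all add: R_def S_def pD qD pq vector_smult_assoc)
    then have "bij (S t)" by (intro o_bij[of R]) auto
    then have "bij (P \<circ> S t)" using P(2) by (rule bij_comp)
    moreover have "S t (D t a b) = m (S t a) (S t b)" for a b
    proof -
      have "{..3::nat} = {0,1,2,3}" by auto
      then have D: "D t a b = \<psi> 0 a b + t *s \<psi> 1 a b + t^2 *s \<psi> 2 a b + t^3 *s \<psi> 3 a b"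
        by (simp add: D_def add_ac)
      define A where "A = m (p a) (p b)"
      define B where "B = m (p a) (q b) + m (q a) (p b)"
      define C where "C = m (q a) (q b)"
      have "m (S t a) (S t b) = t^2 *s A + t^3 *s B + t^4 *s C"
        by (simp add: S_def mD A_def B_def C_def vec_eq_iff algebra_simps power2_eq_square
              eval_nat_numeral)
      also have "\<dots> = t^2 *s (p A + q A) + t^3 *s (p B + q B) + t^4 *s (p C + q C)"
        unfolding pq(1) ..
      also have "\<dots> = S t (q A + t *s (p A + q B) + t^2 *s (p B + q C) + t^3 *s p C)"
        unfolding S_def
        by (simp add: pD qD pq(2-) vec_eq_iff algebra_simps eval_nat_numeral)
      also have "q A + t *s (p A + q B) + t^2 *s (p B + q C) + t^3 *s p C = D t a b"
        unfolding D by (simp add: \<psi>_def A_def B_def C_def)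
      finally show ?thesis ..
    qed
    ultimately show ?thesis
      unfolding isomorphic_def using lin by (intro exI[of _ "P \<circ> S t"]) (simp add: Pm)
  qed
  moreover have "associative (D t)" for t
  proof (cases "t = 0")
    case True
    then have "D t = \<psi> 0" by (intro ext) (simp add: D_def power_0_left if_distrib[of "\<lambda>c. c *s _"] cong: if_cong)
    then show ?thesis
      by (simp add: psi0 associative_def d15_def psi_def)
  next
    case False
    then show ?thesis using iso associative_isomorphic \<open>associative g\<close> by blast
  qed
  ultimately show ?thesis
    unfolding jump_deformation_def using psi0 \<open>\<not> isomorphic d15 g\<close>
    by (intro conjI exI[of _ \<psi>] exI[of _ D] exI[of _ "1::real"]) auto
qed

text \<open>It is enough to follow the \<open>e 2\<close> coordinate of the square of \<open>e 1\<close>: it is a convergent power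
  series in \<open>t\<close> with constant term \<open>1\<close>, but proportionality makes it vanish for \<open>t \<noteq> 0\<close>.\<close>

lemma d15_no_jump_deformation:
  assumes mult: "\<And>u. \<exists>c. g u u = c *s u"
  shows "\<not> jump_deformation d15 g"
proof
  assume "jump_deformation d15 g"
  then obtain \<psi> D and \<epsilon> :: real where \<psi>: "\<psi> 0 = d15" "\<epsilon> > 0"
    and S: "\<And>t u v. norm t < \<epsilon> \<Longrightarrow> (\<lambda>n. t ^ n *s \<psi> n u v) sums D t u v"
    and iso: "\<And>t. t \<noteq> 0 \<Longrightarrow> norm t < \<epsilon> \<Longrightarrow> isomorphic (D t) g"
    unfolding jump_deformation_def by blast
  define f where "f t = D t (e 1) (e 1) $ 2" for t
  have "(\<lambda>n. \<psi> n (e 1) (e 1) $ 2 * t ^ n) sums f t" if "norm t < \<epsilon>" for t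
    using bounded_linear.sums[OF bounded_linear_vec_nth S[OF that, of "e 1" "e 1"], of 2]
    by (simp add: f_def mult.commute)
  then have "(f \<longlongrightarrow> \<psi> 0 (e 1) (e 1) $ 2) (at 0)"
    using powser_limit_0[OF \<psi>(2), of "\<lambda>n. \<psi> n (e 1) (e 1) $ 2" f] by blast
  then have "(f \<longlongrightarrow> 1) (at 0)"
    by (simp add: \<psi> d15_def psi_def)
  moreover have "f t = 0" if t: "t \<noteq> 0" "norm t < \<epsilon>" for t
  proof -
    obtain \<phi> where lin: "complex_linear \<phi>" and "bij \<phi>"
      and hom: "\<And>u v. \<phi> (D t u v) = g (\<phi> u) (\<phi> v)"
      using iso[OF t] unfolding isomorphic_def by blast
    obtain c where "g (\<phi> (e 1)) (\<phi> (e 1)) = c *s \<phi> (e 1)" using mult by blast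
    then have "\<phi> (D t (e 1) (e 1)) = \<phi> (c *s e 1)"
      by (simp add: hom complex_linearD[OF lin])
    then have "D t (e 1) (e 1) = c *s e 1" using \<open>bij \<phi>\<close> by (meson bij_is_inj injD)
    then show ?thesis by (simp add: f_def)
  qed
  then have "(f \<longlongrightarrow> 0) (at 0)"
    using \<psi>(2) by (intro tendsto_eventually) (auto simp: eventually_at intro!: exI[of _ \<epsilon>])
  ultimately show False using tendsto_unique[of "at (0::complex)" f 0 1] by simp
qed

section \<open>Invariants of \<open>d15\<close>\<close>

text \<open>All products of three vectors vanish in \<open>d15\<close>.\<close>

lemma not_isomorphic_d15_if_cube:
  assumes "g (g u u) u \<noteq> 0"
  shows "\<not> isomorphic d15 g"
proof
  assume "isomorphic d15 g"
  then obtain \<phi> where lin: "complex_linear \<phi>" and "bij \<phi>"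
    and hom: "\<And>u v. \<phi> (d15 u v) = g (\<phi> u) (\<phi> v)"
    unfolding isomorphic_def by blast
  obtain a where "u = \<phi> a" using \<open>bij \<phi>\<close> by (meson bij_pointE)
  then have "g (g u u) u = \<phi> (d15 (d15 a a) a)" by (simp add: hom)
  also have "\<dots> = \<phi> (0 *s 0)" by (simp add: d15_def psi_def)
  also have "\<dots> = 0" by (simp only: complex_linearD[OF lin]) simp
  finally show False using assms by simp
qed

text \<open>The product of \<open>u\<close> and \<open>v\<close> in \<open>d15\<close> is \<open>l u * l v\<close> times \<open>e 2\<close> for a linear form \<open>l\<close>, so a
  vector with zero square lies in the kernel of \<open>l\<close> and annihilates everything. This detects the
  nilpotent algebras in which all products of three vectors vanish as well.\<close>

lemma not_isomorphic_d15_if_square_zero: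
  assumes "g 0 0 = 0" and "g u u = 0" and "g u v \<noteq> 0 \<or> g v u \<noteq> 0"
  shows "\<not> isomorphic d15 g"
proof
  assume "isomorphic d15 g"
  then obtain \<phi> where lin: "complex_linear \<phi>" and "bij \<phi>"
    and hom: "\<And>u v. \<phi> (d15 u v) = g (\<phi> u) (\<phi> v)"
    unfolding isomorphic_def by blast
  obtain a b where ab: "u = \<phi> a" "v = \<phi> b" using \<open>bij \<phi>\<close> by (meson bij_pointE)
  have zero: "\<phi> 0 = 0" using complex_linearD(2)[OF lin, of 0 0] by simp
  have "\<phi> (d15 a a) = \<phi> 0" using assms(2) by (simp add: ab hom zero)
  then have "d15 a a = 0" using \<open>bij \<phi>\<close> by (meson bij_is_inj injD)
  then have "a $ 1 = 0" by (simp add: d15_def psi_def vec_eq_iff forall_3)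
  then have "d15 a b = 0" "d15 b a = 0" by (simp_all add: d15_def psi_def)
  then have "g u v = 0" "g v u = 0" using zero by (simp_all add: ab flip: hom)
  then show False using assms(3) by simp
qed

section \<open>The listed algebras\<close>

lemmas d_defs = d1_def d2_def d3_def d4_def d5_def d6_def d7_def d8_def d9_def d10_def d11_def
  d12_def d13_def d14_def d16_def d17_def d18_def d19_def d20_def d21_def d22_def psi_def

lemma complex_bilinear_listed:
  "\<forall>d \<in> {d1, d2, d3, d4, d5, d6, d9, d10, d11, d12, d13, d14, d16, d17, d18, d19, d21}.
     complex_bilinear d"
  "complex_bilinear (d22 x y)"
  by (auto intro!: complex_bilinearI simp: d_defs vec_eq_iff algebra_simps)

lemma associative_listed:
  "\<forall>d \<in> {d1, d2, d3, d4, d5, d6, d9, d10, d11, d12, d13, d14, d16, d17, d18, d19, d21}.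
     associative d"
  "associative (d22 x y)"
  by (auto simp: associative_def d_defs vec_eq_iff forall_3 algebra_simps)

lemma not_isomorphic_d15_listed:
  "\<forall>d \<in> {d1, d2, d3, d4, d5, d6, d9, d10, d11, d12, d13, d14, d16, d17, d18, d19, d21}.
     \<not> isomorphic d15 d"
proof -
  have "\<forall>d \<in> {d1, d2, d3, d4, d5, d6, d9, d10, d11, d12, d13, d14, d16, d17, d18}.
     d (d (e 1) (e 1)) (e 1) \<noteq> 0"
    by (simp add: d_defs vec_eq_iff forall_3)
  moreover have "d19 (d19 (e 3) (e 3)) (e 3) \<noteq> 0"
    by (simp add: d_defs vec_eq_iff forall_3)
  moreover have "\<not> isomorphic d15 d21"
    by (rule not_isomorphic_d15_if_square_zero[of _ "e 2" "e 1"])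
      (simp_all add: d_defs vec_eq_iff forall_3)
  ultimately show ?thesis by (auto dest: not_isomorphic_d15_if_cube)
qed

lemma nonproportional_square_listed:
  "\<forall>d \<in> {d1, d2, d3, d4, d5, d6, d9, d10, d11, d12, d13, d14, d16, d17, d18, d19, d21}.
     \<exists>u. \<forall>c. d u u \<noteq> c *s u"
proof -
  \<comment> \<open>The coordinates \<open>1\<close> and \<open>2\<close> must differ where \<open>e 1\<close> and \<open>e 2\<close> are orthogonal idempotents, as
    in \<open>d14\<close>: there \<open>e 1 + e 2\<close> is itself idempotent. The same holds for \<open>e 1\<close> and \<open>e 3\<close> in \<open>d10\<close>.\<close>
  have "\<forall>d \<in> {d1, d2, d3, d4, d5, d6, d11, d12, d13, d14}. \<forall>c.
      d (vector [1, 2, 0]) (vector [1, 2, 0]) \<noteq> c *s vector [1, 2, 0]"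
    by (auto simp: d_defs vec_eq_iff forall_3)
  moreover have "\<forall>d \<in> {d9, d10}. \<forall>c.
      d (vector [1, 0, 2]) (vector [1, 0, 2]) \<noteq> c *s vector [1, 0, 2]"
    by (auto simp: d_defs vec_eq_iff forall_3)
  moreover have "\<forall>d \<in> {d16, d17, d18, d19, d21}. \<forall>c. d (e 1) (e 1) \<noteq> c *s e 1"
    by (auto simp: d_defs vec_eq_iff forall_3)
  ultimately show ?thesis by blast
qed

lemma d15_jump_deformation_d22:
  assumes "x + y \<noteq> 0"
  shows "jump_deformation d15 (d22 x y)"
proof (rule d15_jump_deformation)
  show "\<not> isomorphic d15 (d22 x y)"
    using assms
    by (intro not_isomorphic_d15_if_square_zero[of _ "e 1" "e 2"])
      (auto simp: d_defs vec_eq_iff forall_3)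
  show "d22 x y (vector [1, 1, 0]) (vector [1, 1, 0]) \<noteq> c *s vector [1, 1, 0]" for c
    using assms by (simp add: d_defs vec_eq_iff forall_3)
qed (rule complex_bilinear_listed associative_listed)+

lemma proportional_square_listed:
  "\<forall>d \<in> {d7, d8, d20}. \<forall>u. d u u = u $ 1 *s u"
  "d22 x (- x) u u = 0 *s u"
  by (auto simp: d_defs vec_eq_iff forall_3 algebra_simps)

lemma same_point_iff:
  assumes "(x, y) \<noteq> (0, 0)"
  shows "same_point (x, y) (1, -1) \<longleftrightarrow> y = - x"
  using assms by (auto simp: same_point_def)

theorem mainTheorem4:
  shows "(\<forall>d' \<in> {d1, d2, d3, d4, d5, d6, d9, d10, d11, d12, d13, d14, d16, d17, d18, d19, d21}.
            jump_deformation d15 d') \<and>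
         (\<forall>x y. (x, y) \<noteq> (0, 0) \<and> \<not> same_point (x, y) (1, -1) \<longrightarrow> jump_deformation d15 (d22 x y)) \<and>
         (\<forall>d' \<in> {d7, d8, d15, d20}. \<not> jump_deformation d15 d') \<and>
         (\<forall>x y. (x, y) \<noteq> (0, 0) \<and> same_point (x, y) (1, -1) \<longrightarrow> \<not> jump_deformation d15 (d22 x y))"
proof (intro conjI allI impI)
  show "\<forall>d' \<in> {d1, d2, d3, d4, d5, d6, d9, d10, d11, d12, d13, d14, d16, d17, d18, d19, d21}.
            jump_deformation d15 d'"
  proof
    fix d' assume d': "d' \<in> {d1, d2, d3, d4, d5, d6, d9, d10, d11, d12, d13, d14, d16, d17, d18, d19, d21}"
    then obtain u where "\<And>c. d' u u \<noteq> c *s u" using nonproportional_square_listed by meson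
    with d' show "jump_deformation d15 d'"
      using d15_jump_deformation complex_bilinear_listed(1) associative_listed(1)
        not_isomorphic_d15_listed by meson
  qed
next
  fix x y :: complex
  assume "(x, y) \<noteq> (0, 0) \<and> \<not> same_point (x, y) (1, -1)"
  then have "x + y \<noteq> 0" using same_point_iff by (metis minus_unique)
  then show "jump_deformation d15 (d22 x y)" by (rule d15_jump_deformation_d22)
next
  have "\<not> jump_deformation d15 d'" if "d' \<in> {d7, d8, d20}" for d'
    using that proportional_square_listed(1) by (intro d15_no_jump_deformation) blast
  moreover have "\<not> jump_deformation d15 d15"
    by (simp add: jump_deformation_def isomorphic_refl)
  ultimately show "\<forall>d' \<in> {d7, d8, d15, d20}. \<not> jump_deformation d15 d'" by blast
next
  fix x y :: complex
  assume "(x, y) \<noteq> (0, 0) \<and> same_point (x, y) (1, -1)"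
  then have "y = - x" using same_point_iff by blast
  then show "\<not> jump_deformation d15 (d22 x y)"
    using proportional_square_listed(2) by (intro d15_no_jump_deformation) blast
qed

end
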